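(* Let $\lambda$ be a cardinal with $2^{<\lambda}=\lambda>\omega$. Let $Y$ be a $T_0$ topological space of weight at most $\lambda$. Then there is no continuous $\lambda^+$-measure space $(Y,\mathfrak{M},\mu)$ (for any choice of positively totally ordered monoid $\mathbb{S}$ with infinitary sum $\mathsf{Sum}$ in which $\mu$ takes its values).
   Context: **Monoids and sums.** A positively totally ordered monoid is $\mathbb{S}=(S,0,+,\leq)$ where $+$ is associative (not necessarily commutative) with neutral element $0$, $\leq$ is a total order, $a\leq b$ and $c\leq d$ imply $a+c\leq b+d$, $0$ is the minimum of $\leq$, and $S\neq\{0\}$. ${}^{<\mathrm{On}}\mathbb{S}$ is the class of all sequences of elements of $S$ of ordinal length; $\mathrm{lh}(s)$ is the length of $s$. An infinitary sum on $\mathbb{S}$ is a partial function $\mathsf{Sum}:{}^{<\mathrm{On}}\mathbb{S}\to\mathbb{S}$ such that: (S1) $\mathsf{Sum}(\emptyset)=0$ and $\mathsf{Sum}(s)=s_0+\dots+s_n$ for every non-empty finite $s=(s_i)_{i\leq n}\in\mathrm{dom}(\mathsf{Sum})$; (S2) (continuity) for all $s\in\mathrm{dom}(\mathsf{Sum})$ of limit length, if $s\restriction\alpha\in\mathrm{dom}(\mathsf{Sum})$ for cofinally many $\alpha<\mathrm{lh}(s)$, then $\mathsf{Sum}(s)=\sup\{\mathsf{Sum}(s\restriction\alpha)\mid\alpha<\mathrm{lh}(s),\ s\restriction\alpha\in\mathrm{dom}(\mathsf{Sum})\}$. **Measures.** A $\lambda^+$-measurable space is a pair $(Y,\mathfrak{M})$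 where $Y$ is a topological space and $\mathfrak{M}$ is a $\lambda^+$-algebra on $Y$ (a family of subsets closed under complements and under unions and intersections of size at most $\lambda$) containing all open subsets of $Y$. A $\lambda^+$-measure on it (with values in $(\mathbb{S},\mathsf{Sum})$) is a partial function $\mu:\mathscr{P}(Y)\to\mathbb{S}$ with $\mathfrak{M}\subseteq\mathrm{dom}(\mu)$ such that: (M1) $\mu(\emptyset)=0$; (M2) $\mu(Y)>0$; (M3) $A\subseteq B$ implies $\mu(A)\leq\mu(B)$ for all $A,B\in\mathfrak{M}$; (M4) for every family $(A_i)_{i<\gamma}$ of pairwise disjoint sets of $\mathfrak{M}$ of length an ordinal $\gamma<\lambda^+$, we have $\langle\mu(A_i)\mid i<\gamma\rangle\in\mathrm{dom}(\mathsf{Sum})$ and $\mu(\bigcup_{i<\gamma}A_i)=\mathsf{Sum}(\langle\mu(A_i)\mid i<\gamma\rangle)$; (M5) for every $x\in Y$ with $\{x\}\in\mathfrak{M}$ and every open local basis $\{A_i\mid i<\gamma\}$ at $x$ with $\gamma<\lambda^+$, $\mu(\{x\})=\inf_{i<\gamma}\mu(A_i)$. Then $(Y,\mathfrak{M},\mu)$ is called a $\lambda^+$-measure space. It is continuous if $\{x\}\in\mathfrak{M}$ and $\mu(\{x\})=0$ for every $x\in Y$. Here $2^{<\lambda}=\sup\{2^{\theta}\mid\theta<\lambda\text{ a cardinal}\}$. *)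

theory Defs
  imports "HOL-Analysis.Analysis" "HOL-Library.Lub_Glb" "HOL-Library.Disjoint_Sets"
begin

unbundle cardinal_syntax

section \<open>Cardinals\<close>

text \<open>
  Cardinals are represented, as in Main, by relations satisfying \<^const>\<open>card_order_on\<close>.
  The relation below says that the cardinal \<open>mu\<close> is \<open>2\<close> to the weak power \<open>lam\<close>, that is, the
  supremum of all \<open>2\<close> to the power \<open>theta\<close> with \<open>theta < lam\<close> a cardinal. Since every cardinal
  below \<open>lam\<close> is represented on a subset of the field of \<open>lam\<close>, letting \<open>theta\<close> range over
  relations on the same type loses nothing; likewise for \<open>kappa\<close> and \<open>mu\<close>.
\<close>

definition is_weak_power_of_two :: "'l rel \<Rightarrow> 'm rel \<Rightarrow> bool" where
  "is_weak_power_of_two lam mu \<longleftrightarrow>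
     Card_order mu \<and>
     (\<forall>theta :: 'l rel. Card_order theta \<and> theta <o lam \<longrightarrow> ctwo ^c theta \<le>o mu) \<and>
     (\<forall>kappa :: 'm rel. Card_order kappa \<and>
        (\<forall>theta :: 'l rel. Card_order theta \<and> theta <o lam \<longrightarrow> ctwo ^c theta \<le>o kappa)
        \<longrightarrow> mu \<le>o kappa)"

section \<open>Topological notions\<close>

definition is_base :: "'y topology \<Rightarrow> 'y set set \<Rightarrow> bool" where
  "is_base Y B \<longleftrightarrow> openin Y = arbitrary union_of (\<lambda>U. U \<in> B)"

definition weight :: "'y topology \<Rightarrow> 'y set rel" where
  "weight Y = |SOME B. is_base Y B \<and> (\<forall>B'. is_base Y B' \<longrightarrow> |B| \<le>o |B'| )|"

definition is_open_local_basis :: "'y topology \<Rightarrow> 'y \<Rightarrow> 'y set set \<Rightarrow> bool" where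
  "is_open_local_basis Y x B \<longleftrightarrow>
     (\<forall>U\<in>B. openin Y U \<and> x \<in> U) \<and>
     (\<forall>V. openin Y V \<and> x \<in> V \<longrightarrow> (\<exists>U\<in>B. U \<subseteq> V))"

lemma ex_minimal_base:
  "\<exists>B. is_base Y B \<and> (\<forall>B'. is_base Y B' \<longrightarrow> |B| \<le>o |B'| )"
proof -
  have "is_base Y (Collect (openin Y))"
    unfolding is_base_def openin_topology_base_unique by auto
  then have "{|B| | B. is_base Y B} \<noteq> {}" by blast
  moreover have "\<forall>r \<in> {|B| | B. is_base Y B}. Card_order r" by (auto intro: card_of_Card_order)
  ultimately obtain r where "r \<in> {|B| | B. is_base Y B}"
      "\<forall>r' \<in> {|B| | B. is_base Y B}. r \<le>o r'"
    using exists_minim_Card_order by meson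
  then show ?thesis by blast
qed

lemma weight_ordLeq_iff:
  "weight Y \<le>o lam \<longleftrightarrow> (\<exists>B. is_base Y B \<and> |B| \<le>o lam)"
  using someI_ex[OF ex_minimal_base[of Y]] ordLeq_transitive
  unfolding weight_def by blast

section \<open>Monoids and infinitary sums\<close>

class positively_totally_ordered_monoid = monoid_add + linorder +
  assumes add_le_add: "a \<le> b \<Longrightarrow> c \<le> d \<Longrightarrow> a + c \<le> b + d"
    and zero_least: "0 \<le> a"
    and nontrivial: "\<exists>a. a \<noteq> 0"

text \<open>
  Ordinals are represented by the elements of (the field of) a well-order \<open>W\<close>, an element \<open>g\<close>
  being identified with its set \<open>underS W g\<close> of predecessors. A sequence of length \<open>g\<close> is a
  partial function with domain \<open>underS W g\<close>.

  HOL has no class of all ordinals, so \<open>W\<close> is an arbitrary initial segment of it, and infinitary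
  sums are considered on sequences whose length belongs to \<open>W\<close>. As the axioms for a sequence only
  involve its initial segments, an infinitary sum on all sequences restricts to such a one.
  For \<open>lam\<close>-additive measures it suffices that \<open>W\<close> has an element for every ordinal below the
  cardinal successor of \<open>lam\<close>, i.e. \<open>cardSuc lam \<le>o W\<close>.
\<close>

definition ordinal_sequences :: "'o rel \<Rightarrow> ('o \<rightharpoonup> 's) set" where
  "ordinal_sequences W = {s. \<exists>g \<in> Field W. dom s = underS W g}"

definition limit_ordinal :: "'o rel \<Rightarrow> 'o \<Rightarrow> bool" where
  "limit_ordinal W g \<longleftrightarrow> underS W g \<noteq> {} \<and> (\<forall>a \<in> underS W g. \<exists>b \<in> underS W g. a \<in> underS W b)"

text \<open>
  In the second clause \<open>xs\<close> is the increasing enumeration of the indices of a finite sequence.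
\<close>

definition infinitary_sum ::
  "'o rel \<Rightarrow> (('o \<rightharpoonup> 's) \<rightharpoonup> 's :: positively_totally_ordered_monoid) \<Rightarrow> bool" where
  "infinitary_sum W isum \<longleftrightarrow>
     dom isum \<subseteq> ordinal_sequences W \<and>
     isum Map.empty = Some 0 \<and>
     (\<forall>s xs. s \<in> dom isum \<and> set xs = dom s \<and> sorted_wrt (\<lambda>i j. i \<in> underS W j) xs
        \<longrightarrow> isum s = Some (sum_list (map (\<lambda>i. the (s i)) xs))) \<and>
     (\<forall>s g. s \<in> dom isum \<and> dom s = underS W g \<and> limit_ordinal W g \<and>
        (\<forall>b \<in> underS W g. \<exists>a \<in> underS W g. (b, a) \<in> W \<and> s |` underS W a \<in> dom isum)
        \<longrightarrow> isLub UNIV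
              {the (isum (s |` underS W a)) | a. a \<in> underS W g \<and> s |` underS W a \<in> dom isum}
              (the (isum s)))"

section \<open>Measures\<close>

text \<open>
  In the following, \<open>lam\<close> is the cardinal whose successor is the parameter of the notion defined.
\<close>

definition succ_algebra :: "'l rel \<Rightarrow> 'y set \<Rightarrow> 'y set set \<Rightarrow> bool" where
  "succ_algebra lam X M \<longleftrightarrow>
     M \<subseteq> Pow X \<and>
     (\<forall>A \<in> M. X - A \<in> M) \<and>
     (\<forall>F. F \<subseteq> M \<and> |F| \<le>o lam \<longrightarrow> \<Union>F \<in> M) \<and>
     (\<forall>F. F \<subseteq> M \<and> F \<noteq> {} \<and> |F| \<le>o lam \<longrightarrow> \<Inter>F \<in> M)"

definition succ_measurable_space :: "'l rel \<Rightarrow> 'y topology \<Rightarrow> 'y set set \<Rightarrow> bool" where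
  "succ_measurable_space lam Y M \<longleftrightarrow>
     succ_algebra lam (topspace Y) M \<and> (\<forall>U. openin Y U \<longrightarrow> U \<in> M)"

definition ordinals_below_succ :: "'o rel \<Rightarrow> 'l rel \<Rightarrow> 'o set" where
  "ordinals_below_succ W lam = {g \<in> Field W. Restr W (underS W g) <o cardSuc lam}"

definition succ_measure ::
  "'o rel \<Rightarrow> (('o \<rightharpoonup> 's) \<rightharpoonup> 's) \<Rightarrow> 'l rel \<Rightarrow> 'y topology \<Rightarrow> 'y set set \<Rightarrow>
     ('y set \<rightharpoonup> 's :: positively_totally_ordered_monoid) \<Rightarrow> bool" where
  "succ_measure W isum lam Y M mu \<longleftrightarrow>
     dom mu \<subseteq> Pow (topspace Y) \<and> M \<subseteq> dom mu \<and>
     the (mu {}) = 0 \<and>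
     the (mu (topspace Y)) > 0 \<and>
     (\<forall>A \<in> M. \<forall>B \<in> M. A \<subseteq> B \<longrightarrow> the (mu A) \<le> the (mu B)) \<and>
     (\<forall>g \<in> ordinals_below_succ W lam. \<forall>A.
        A ` underS W g \<subseteq> M \<and> disjoint_family_on A (underS W g)
        \<longrightarrow> (mu \<circ> A) |` underS W g \<in> dom isum \<and>
            the (mu (\<Union>i \<in> underS W g. A i)) = the (isum ((mu \<circ> A) |` underS W g))) \<and>
     (\<forall>x \<in> topspace Y. {x} \<in> M \<longrightarrow>
        (\<forall>g \<in> ordinals_below_succ W lam. \<forall>A.
           is_open_local_basis Y x (A ` underS W g)
           \<longrightarrow> isGlb UNIV ((\<lambda>i. the (mu (A i))) ` underS W g) (the (mu {x}))))"

definition succ_measure_space ::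
  "'o rel \<Rightarrow> (('o \<rightharpoonup> 's) \<rightharpoonup> 's) \<Rightarrow> 'l rel \<Rightarrow> 'y topology \<Rightarrow> 'y set set \<Rightarrow>
     ('y set \<rightharpoonup> 's :: positively_totally_ordered_monoid) \<Rightarrow> bool" where
  "succ_measure_space W isum lam Y M mu \<longleftrightarrow>
     succ_measurable_space lam Y M \<and> succ_measure W isum lam Y M mu"

definition continuous_succ_measure_space ::
  "'o rel \<Rightarrow> (('o \<rightharpoonup> 's) \<rightharpoonup> 's) \<Rightarrow> 'l rel \<Rightarrow> 'y topology \<Rightarrow> 'y set set \<Rightarrow>
     ('y set \<rightharpoonup> 's :: positively_totally_ordered_monoid) \<Rightarrow> bool" where
  "continuous_succ_measure_space W isum lam Y M mu \<longleftrightarrow>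
     succ_measure_space W isum lam Y M mu \<and>
     (\<forall>x \<in> topspace Y. {x} \<in> M \<and> the (mu {x}) = 0)"

end

(*
  Only two consequences of the hypotheses on lam are used: lam is infinite and 2^omega <= lam.
  Continuity of infinitary sums makes the measure continuous along increasing unions of length at
  most lam, so unions of at most lam null sets are null. By (M5) the space is covered by at most
  lam sets of measure less than any prescribed e > 0. If e + e = e, the same continuity bounds the
  measure of the whole space by e; hence no idempotent lies strictly between 0 and mu(Y). On a set
  E with 0 < mu(E) < mu(Y), infinitely many disjoint sets of measure at least e, whose finite
  unions have measure bounded by multiples of e, would have an idempotent as their total measure,
  and this forces E to be covered by finitely many sets of measure at most e, for every e > 0.
  Since Y is T0, every set of positive measure splits into two such sets, so there are d_n > 0 with
  d_(n+1) + d_(n+1) < d_n and d_0 < mu(E). If some e > 0 is below all d_n, a finite cover by sets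
  of measure at most e gives mu(E) <= d_0. Otherwise finite covers by sets of measure at most d_n,
  for all n, write E as a union of at most 2^omega null sets. Both are impossible.
*)
theory Submission
  imports Defs "HOL-Library.Countable_Set_Type"
begin

section \<open>Ordinals and cardinals\<close>

lemma isLub_UNIV_iff:
  "isLub UNIV S x \<longleftrightarrow> (\<forall>y\<in>S. y \<le> x) \<and> (\<forall>u. (\<forall>y\<in>S. y \<le> u) \<longrightarrow> x \<le> u)"
  unfolding isLub_def leastP_def isUb_def setle_def setge_def by auto

lemma isGlb_UNIV_iff:
  "isGlb UNIV S x \<longleftrightarrow> (\<forall>y\<in>S. x \<le> y) \<and> (\<forall>u. (\<forall>y\<in>S. u \<le> y) \<longrightarrow> u \<le> x)"
  unfolding isGlb_def greatestP_def isLb_def setle_def setge_def by auto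

section \<open>Initial segments of the well-order as ordinals\<close>

lemma underS_Restr_underS:
  assumes "Well_order W" and "a \<in> underS W g"
  shows "underS W a \<subseteq> underS W g" and "Restr W (underS W a) \<le>o Restr W (underS W g)"
proof -
  have wo: "wo_rel W" by (simp add: wo_rel_def assms(1))
  show sub: "underS W a \<subseteq> underS W g"
    using assms(2) wo_rel.TRANS[OF wo] wo_rel.ANTISYM[OF wo]
    by (intro underS_incr) (auto simp: underS_def)
  then show "Restr W (underS W a) \<le>o Restr W (underS W g)"
    using assms(1) wo_rel.underS_ofilter[OF wo] by (simp add: ofilter_subset_ordLeq)
qed

lemma Field_Restr_underS:
  assumes "Well_order W"
  shows "Field (Restr W (underS W g)) = underS W g"
  by (rule Field_Restr_ofilter[OF assms wo_rel.underS_ofilter[unfolded wo_rel_def, OF assms]])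

lemma ordinals_below_succ_downward:
  assumes "Well_order W" and "g \<in> ordinals_below_succ W lam" and "a \<in> underS W g"
  shows "a \<in> ordinals_below_succ W lam"
proof -
  have "Restr W (underS W a) <o cardSuc lam"
    using assms(2) ordLeq_ordLess_trans[OF underS_Restr_underS(2)[OF assms(1,3)]]
    unfolding ordinals_below_succ_def by blast
  moreover have "a \<in> Field W" using assms(3) by (auto simp: underS_def Field_def)
  ultimately show ?thesis unfolding ordinals_below_succ_def by blast
qed

text \<open>Some initial segment of \<open>W\<close> is isomorphic to \<open>lam\<close>, and any
  nonempty set of size at most \<open>lam\<close> is an image of it. Repetitions are allowed, so a
  single length serves all such sets.\<close>

lemma enumeration_below_succ:
  fixes lam :: "'l rel" and F :: "'x set"
  assumes "Well_order W" and "cardSuc lam \<le>o W" and "Card_order lam"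
    and "|F| \<le>o lam" and "F \<noteq> {}"
  obtains g A where "g \<in> ordinals_below_succ W lam" and "A ` underS W g = F"
proof -
  have "lam <o W" using assms(2,3) cardSuc_greater ordLess_ordLeq_trans by blast
  then obtain g where g: "g \<in> Field W" "lam =o Restr W (underS W g)"
    using assms(1,3) ordLess_iff_ordIso_Restr card_order_on_well_order_on by blast
  then have below: "g \<in> ordinals_below_succ W lam"
    using cardSuc_greater[OF assms(3)] ordIso_symmetric ordIso_ordLess_trans
    unfolding ordinals_below_succ_def by blast
  have "lam =o |Field lam|" using assms(3) card_of_Field_ordIso ordIso_symmetric by blast
  moreover have "|Field lam| \<le>o |underS W g|"
    using card_of_mono2[OF ordIso_imp_ordLeq[OF g(2)]] Field_Restr_underS[OF assms(1)] by simp
  ultimately have "|F| \<le>o |underS W g|"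
    by (rule ordLeq_transitive[OF ordLeq_ordIso_trans[OF assms(4)]])
  with card_of_ordLeq2[OF assms(5), of "underS W g"] obtain A where "A ` underS W g = F" by auto
  then show thesis by (rule that[OF below])
qed

text \<open>Since omega is below the successor of \<open>lam\<close>, it is an initial segment of
  \<open>W\<close>; \<open>f n\<close> plays the role of the ordinal n.\<close>

lemma embedding_omega:
  fixes lam :: "'l rel"
  assumes "Well_order W" and "cardSuc lam \<le>o W" and "Card_order lam" and "natLeq \<le>o lam"
  obtains g f where "g \<in> ordinals_below_succ W lam" and "underS W g = range f" and "inj f"
    and "\<And>n::nat. underS W (f n) = f ` {..<n}"
proof -
  have 1: "natLeq <o cardSuc lam"
    using assms(3,4) cardSuc_greater ordLeq_ordLess_trans by blast
  then have "natLeq <o W" using assms(2) ordLess_ordLeq_trans by blast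
  then obtain g where g: "g \<in> Field W" "natLeq =o Restr W (underS W g)"
    using assms(1) ordLess_iff_ordIso_Restr natLeq_Well_order by blast
  then have below: "g \<in> ordinals_below_succ W lam"
    using 1 ordIso_symmetric ordIso_ordLess_trans
    unfolding ordinals_below_succ_def by blast
  obtain f where "iso natLeq (Restr W (underS W g)) f"
    using g(2) unfolding ordIso_def by blast
  then have bij: "bij_betw f UNIV (underS W g)"
    and ord: "\<And>a b. a \<le> b \<longleftrightarrow> (f a, f b) \<in> Restr W (underS W g)"
    unfolding iso_iff2 Field_natLeq Field_Restr_underS[OF assms(1)]
    by (auto simp: natLeq_def)
  have range: "underS W g = range f" and inj: "inj f" using bij by (auto simp: bij_betw_def)
  have "(f a, f b) \<in> W \<longleftrightarrow> a \<le> b" for a b using ord[of a b] range by auto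
  then have less: "f a \<in> underS W (f b) \<longleftrightarrow> a < b" for a b
    using inj by (simp add: underS_def inj_eq less_le conj_commute)
  have "underS W (f n) = f ` {..<n}" for n
  proof -
    have "f n \<in> underS W g" using range by blast
    then have "underS W (f n) \<subseteq> range f" using underS_Restr_underS(1)[OF assms(1)] range by metis
    then show ?thesis using less by blast
  qed
  then show thesis using that below range inj by blast
qed

lemma nat_functions_ordLeq:
  fixes lam :: "'l rel"
  assumes "Card_order lam" and "is_weak_power_of_two lam lam" and "natLeq <o lam"
  shows "|UNIV :: (nat \<Rightarrow> nat) set| \<le>o lam"
proof -
  \<comment> \<open>The weak power only speaks of cardinals living on \<open>'l\<close>, so the
    naturals are first copied into that type.\<close>
  obtain N :: "'l set" where N: "|UNIV :: nat set| =o |N|"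
    using ordLess_imp_ordLeq[OF ordIso_ordLess_trans[OF card_of_nat assms(3)]]
      internalize_card_of_ordLeq[of "UNIV :: nat set" lam] by blast
  have "|N| <o lam"
    using ordIso_ordLess_trans[OF ordIso_transitive[OF ordIso_symmetric[OF N] card_of_nat] assms(3)] by simp
  then have "ctwo ^c |N| \<le>o lam"
    using assms(2) card_of_Card_order unfolding is_weak_power_of_two_def by blast
  moreover have "|Pow N| =o ctwo ^c |N|"
    using card_of_Pow_Func unfolding cexp_def ctwo_def by (simp add: Field_card_of)
  ultimately have Pow: "|Pow N| \<le>o lam" using ordIso_ordLeq_trans by blast
  obtain h :: "nat \<Rightarrow> 'l" where h: "bij_betw h UNIV N"
    using N card_of_ordIso by blast
  \<comment> \<open>A function is coded by its graph, a set of pairs encoded as naturals and then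
    copied to \<open>N\<close>.\<close>
  let ?G = "\<lambda>f :: nat \<Rightarrow> nat. h ` range (\<lambda>n. prod_encode (n, f n))"
  have "inj ?G"
  proof (rule injI)
    fix f f' assume "?G f = ?G f'"
    then have "range (\<lambda>n. prod_encode (n, f n)) = range (\<lambda>n. prod_encode (n, f' n))"
      using h by (simp add: bij_betw_def inj_image_eq_iff)
    then have "prod_encode (n, f n) \<in> range (\<lambda>n. prod_encode (n, f' n))" for n by blast
    then have "f n = f' n" for n unfolding image_iff prod_encode_eq by blast
    then show "f = f'" by (rule ext)
  qed
  moreover have "range ?G \<subseteq> Pow N" using h by (auto simp: bij_betw_def)
  ultimately have "|UNIV :: (nat \<Rightarrow> nat) set| \<le>o |Pow N|" using card_of_ordLeq by blast
  then show ?thesis using Pow ordLeq_transitive by blast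
qed

section \<open>Additivity and continuity along transfinite unions\<close>

locale continuous_measure =
  fixes lam :: "'l rel" and W :: "'o rel"
    and isum :: "('o \<rightharpoonup> 's :: positively_totally_ordered_monoid) \<rightharpoonup> 's"
    and Y :: "'y topology" and M :: "'y set set" and mu :: "'y set \<rightharpoonup> 's"
  assumes lam: "Card_order lam" and infinite: "natLeq \<le>o lam"
    and W: "Well_order W" and long: "cardSuc lam \<le>o W"
    and isum: "infinitary_sum W isum"
    and space: "continuous_succ_measure_space W isum lam Y M mu"
begin

abbreviation X :: "'y set" where "X \<equiv> topspace Y"

definition m :: "'y set \<Rightarrow> 's" where "m A = the (mu A)"

section \<open>Measurable sets and elementary laws of the measure\<close>

lemma algebra: "succ_algebra lam X M"
  and open_measurable: "openin Y U \<Longrightarrow> U \<in> M"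
  and measure: "succ_measure W isum lam Y M mu"
  and singleton_measurable: "x \<in> X \<Longrightarrow> {x} \<in> M"
  and singleton_null: "x \<in> X \<Longrightarrow> m {x} = 0"
  using space unfolding continuous_succ_measure_space_def succ_measure_space_def
    succ_measurable_space_def m_def by auto

lemma subset_X: "A \<in> M \<Longrightarrow> A \<subseteq> X"
  and Union_M: "F \<subseteq> M \<Longrightarrow> |F| \<le>o lam \<Longrightarrow> \<Union>F \<in> M"
  and Inter_M: "F \<subseteq> M \<Longrightarrow> F \<noteq> {} \<Longrightarrow> |F| \<le>o lam \<Longrightarrow> \<Inter>F \<in> M"
  and X_M: "X \<in> M"
  using algebra open_measurable unfolding succ_algebra_def by auto

lemma countable_small: "countable F \<Longrightarrow> |F| \<le>o lam"
  using infinite countable_card_le_natLeq ordLeq_transitive by blast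

lemma Un_M: "A \<in> M \<Longrightarrow> B \<in> M \<Longrightarrow> A \<union> B \<in> M"
  using Union_M[of "{A, B}"] countable_small[of "{A, B}"] by simp

lemma Int_M: "A \<in> M \<Longrightarrow> B \<in> M \<Longrightarrow> A \<inter> B \<in> M"
  using Inter_M[of "{A, B}"] countable_small[of "{A, B}"] by simp

lemma Diff_M: "A \<in> M \<Longrightarrow> B \<in> M \<Longrightarrow> A - B \<in> M"
proof -
  assume A: "A \<in> M" and B: "B \<in> M"
  have "X - B \<in> M" using algebra B unfolding succ_algebra_def by blast
  moreover have "A - B = A \<inter> (X - B)" using subset_X[OF A] by blast
  ultimately show "A - B \<in> M" using Int_M[OF A] by simp
qed

lemma UN_nat_M: "(\<And>n::nat. D n \<in> M) \<Longrightarrow> (\<Union>n\<in>N. D n) \<in> M"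
  by (rule Union_M) (auto intro!: countable_small)

lemma m_empty: "m {} = 0" and m_X: "m X > 0"
  and m_mono: "A \<in> M \<Longrightarrow> B \<in> M \<Longrightarrow> A \<subseteq> B \<Longrightarrow> m A \<le> m B"
  using measure unfolding succ_measure_def m_def by auto

lemma M_dom: "A \<in> M \<Longrightarrow> A \<in> dom mu"
  using measure unfolding succ_measure_def by auto

lemma m_sum:
  assumes "g \<in> ordinals_below_succ W lam" and "A ` underS W g \<subseteq> M"
    and "disjoint_family_on A (underS W g)"
  shows "(mu \<circ> A) |` underS W g \<in> dom isum"
    and "m (\<Union>i \<in> underS W g. A i) = the (isum ((mu \<circ> A) |` underS W g))"
  using measure assms unfolding succ_measure_def m_def by blast+

lemma small_enumeration:
  assumes "|F| \<le>o lam" and "F \<noteq> {}"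
  obtains g A where "g \<in> ordinals_below_succ W lam" and "A ` underS W g = F"
  using enumeration_below_succ[OF W long lam assms] by blast

text \<open>(M5) is stated for families indexed by an ordinal; an enumeration with repetitions turns
  it into a statement about sets, and points are null.\<close>

lemma m_local_basis:
  assumes "x \<in> X" and "is_open_local_basis Y x B" and "|B| \<le>o lam"
  shows "isGlb UNIV (m ` B) 0"
proof -
  have "B \<noteq> {}" using assms(1,2) unfolding is_open_local_basis_def by blast
  then obtain g A where g: "g \<in> ordinals_below_succ W lam" and A: "A ` underS W g = B"
    using small_enumeration[OF assms(3)] by metis
  have "\<forall>x \<in> X. {x} \<in> M \<longrightarrow> (\<forall>g \<in> ordinals_below_succ W lam. \<forall>A.
      is_open_local_basis Y x (A ` underS W g)
      \<longrightarrow> isGlb UNIV ((\<lambda>i. the (mu (A i))) ` underS W g) (the (mu {x})))"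
    using measure unfolding succ_measure_def by simp
  then have "isGlb UNIV ((\<lambda>i. m (A i)) ` underS W g) (m {x})"
    using assms(1,2) singleton_measurable g A unfolding m_def by blast
  moreover have "(\<lambda>i. m (A i)) ` underS W g = m ` B" using A by (simp add: image_image flip: A)
  ultimately show ?thesis using singleton_null[OF assms(1)] by simp
qed

text \<open>(M4) for a sequence of length two, evaluated by the finite clause of
  \<open>infinitary_sum\<close>.\<close>

lemma m_Un:
  assumes A: "A \<in> M" and B: "B \<in> M" and disj: "A \<inter> B = {}"
  shows "m (A \<union> B) = m A + m B"
proof -
  obtain g f where g: "g \<in> ordinals_below_succ W lam" and range: "underS W g = range f"
    and inj: "inj f" and segment: "\<And>n::nat. underS W (f n) = f ` {..<n}"
    using embedding_omega[OF W long lam infinite] by metis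
  have f2: "f 2 \<in> ordinals_below_succ W lam"
    using ordinals_below_succ_downward[OF W g] range by blast
  have S: "underS W (f 2) = {f 0, f 1}" and S1: "underS W (f 1) = {f 0}"
    unfolding segment by (auto simp: numeral_2_eq_2 lessThan_Suc)
  have ne: "f 0 \<noteq> f 1" using inj by (simp add: inj_eq)
  \<comment> \<open>Addition need not commute: \<open>A\<close> sits at index 0 so that it becomes
    the left summand.\<close>
  let ?D = "\<lambda>i. if i = f 0 then A else B"
  let ?s = "(mu \<circ> ?D) |` underS W (f 2)"
  have disjD: "disjoint_family_on ?D (underS W (f 2))"
    using disj unfolding S disjoint_family_on_def by auto
  have imD: "?D ` underS W (f 2) \<subseteq> M" using A B unfolding S by auto
  have un: "(\<Union>i \<in> underS W (f 2). ?D i) = A \<union> B" using ne unfolding S by auto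
  have s: "?s \<in> dom isum" and val: "m (A \<union> B) = the (isum ?s)"
    using m_sum[OF f2 imD disjD] unfolding un by auto
  have ma: "mu A = Some (m A)" "mu B = Some (m B)" using M_dom[OF A] M_dom[OF B] by (auto simp: m_def)
  have dom: "set [f 0, f 1] = dom ?s" using ne ma unfolding S
    by (auto simp: restrict_map_def split: if_splits)
  have sorted: "sorted_wrt (\<lambda>i j. i \<in> underS W j) [f 0, f 1]" using S1 by simp
  have "isum ?s = Some (sum_list (map (\<lambda>i. the (?s i)) [f 0, f 1]))"
    using isum s dom sorted unfolding infinitary_sum_def by blast
  also have "\<dots> = Some (m A + m B)" using ne ma unfolding S by simp
  finally show ?thesis using val by simp
qed

lemma m_Un_le:
  assumes A: "A \<in> M" and B: "B \<in> M"
  shows "m (A \<union> B) \<le> m A + m B"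
proof -
  have "m (A \<union> B) = m A + m (B - A)"
    using m_Un[OF A Diff_M[OF B A]] by simp
  also have "\<dots> \<le> m A + m B" by (intro add_le_add m_mono Diff_M A B) auto
  finally show ?thesis .
qed

section \<open>Continuity along unions of ordinal length\<close>

lemma UN_underS_M:
  assumes g: "g \<in> ordinals_below_succ W lam" and A: "A ` underS W g \<subseteq> M"
  shows "(\<Union>i \<in> underS W g. A i) \<in> M"
proof -
  have "Restr W (underS W g) <o cardSuc lam" using g unfolding ordinals_below_succ_def by blast
  moreover have "|underS W g| \<le>o Restr W (underS W g)"
    using card_of_least well_order_on_Restr[OF W Order_Relation.underS_Field] by blast
  ultimately have "|underS W g| <o cardSuc lam" using ordLeq_ordLess_trans by blast
  then have "|underS W g| \<le>o lam" using cardSuc_ordLeq_ordLess[OF lam card_of_Card_order] by blast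
  then have "|A ` underS W g| \<le>o lam" by (rule ordLeq_transitive[OF card_of_image])
  then show ?thesis using A by (intro Union_M)
qed

text \<open>Subtracting from each set the earlier ones gives a disjoint family with the same partial
  unions. By (M4) all its partial sums are defined, so the continuity of \<open>isum\<close>
  applies.\<close>

lemma m_limit:
  assumes g: "g \<in> ordinals_below_succ W lam" and A: "A ` underS W g \<subseteq> M"
    and limit: "limit_ordinal W g"
  shows "isLub UNIV {m (\<Union>i \<in> underS W a. A i) | a. a \<in> underS W g} (m (\<Union>i \<in> underS W g. A i))"
proof -
  define D where "D i = A i - (\<Union>j \<in> underS W i. A j)" for i
  note wo = W[folded wo_rel_def]
  have M: "(\<Union>j \<in> underS W a. A j) \<in> M" if "a \<in> underS W g \<or> a = g" for a
  proof -
    have a: "a \<in> ordinals_below_succ W lam" "underS W a \<subseteq> underS W g"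
      using that g ordinals_below_succ_downward[OF W g] underS_Restr_underS[OF W] by auto
    then show ?thesis using A by (intro UN_underS_M) auto
  qed
  have DM: "D ` underS W g \<subseteq> M" using A M by (auto simp: D_def intro!: Diff_M)
  have disj: "disjoint_family_on D (underS W g)"
  proof -
    have "D i \<inter> D j = {}" if "i \<in> underS W g" "j \<in> underS W g" "i \<noteq> j" for i j
    proof -
      have "i \<in> underS W j \<or> j \<in> underS W i"
        using that wo_rel.TOTALS[OF wo] Order_Relation.underS_Field[of W g] by (auto simp: underS_def)
      then show ?thesis by (auto simp: D_def)
    qed
    then show ?thesis by (auto simp: disjoint_family_on_def)
  qed
  \<comment> \<open>A point lies in \<open>D i\<close> for the least \<open>i\<close> such that it
    lies in \<open>A i\<close>.\<close>
  have un: "(\<Union>j \<in> underS W a. D j) = (\<Union>j \<in> underS W a. A j)" for a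
  proof
    show "(\<Union>j \<in> underS W a. A j) \<subseteq> (\<Union>j \<in> underS W a. D j)"
    proof (rule subsetI, elim UN_E)
      fix y i assume "i \<in> underS W a" "y \<in> A i"
      then show "y \<in> (\<Union>j \<in> underS W a. D j)"
      proof (induction i rule: wo_rel.well_order_induct[OF wo])
        case (1 i)
        show ?case
        proof (cases "\<exists>j \<in> underS W i. y \<in> A j")
          case True
          then show ?thesis using 1 underS_Restr_underS(1)[OF W 1(2)] by (auto simp: underS_def)
        next
          case False
          then show ?thesis using 1 by (auto simp: D_def)
        qed
      qed
    qed
  qed (auto simp: D_def)
  let ?s = "(mu \<circ> D) |` underS W g"
  have val: "(mu \<circ> D) |` underS W a \<in> dom isum"
    "m (\<Union>j \<in> underS W a. A j) = the (isum ((mu \<circ> D) |` underS W a))"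
    if "a \<in> underS W g \<or> a = g" for a
  proof -
    have a: "a \<in> ordinals_below_succ W lam" "underS W a \<subseteq> underS W g"
      using that g ordinals_below_succ_downward[OF W g] underS_Restr_underS[OF W] by auto
    have "D ` underS W a \<subseteq> M" "disjoint_family_on D (underS W a)"
      using DM a(2) disjoint_family_on_mono[OF a(2) disj] by blast+
    from m_sum[OF a(1) this] show "(mu \<circ> D) |` underS W a \<in> dom isum"
      "m (\<Union>j \<in> underS W a. A j) = the (isum ((mu \<circ> D) |` underS W a))"
      unfolding un by auto
  qed
  have restr: "?s |` underS W a = (mu \<circ> D) |` underS W a" if "a \<in> underS W g" for a
    using underS_Restr_underS(1)[OF W that] by (simp add: Int_absorb1)
  have "D i \<in> dom mu" if "i \<in> underS W g" for i using DM M_dom that by blast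
  then have dom: "dom ?s = underS W g" by (auto simp: restrict_map_def dom_def split: if_splits)
  have refl: "(b, b) \<in> W" if "b \<in> underS W g" for b
    using that wo_rel.REFL[OF wo] Order_Relation.underS_Field[of W g] by (auto simp: refl_on_def)
  \<comment> \<open>Every truncation is in the domain, so \<open>b\<close> itself witnesses
    cofinality.\<close>
  have cofinal: "\<forall>b \<in> underS W g. \<exists>a \<in> underS W g. (b, a) \<in> W \<and> ?s |` underS W a \<in> dom isum"
    using refl val(1) restr by metis
  have "isLub UNIV {the (isum (?s |` underS W a)) | a. a \<in> underS W g \<and> ?s |` underS W a \<in> dom isum}
      (the (isum ?s))"
    using isum val(1)[of g] dom limit cofinal unfolding infinitary_sum_def by blast
  moreover have "{the (isum (?s |` underS W a)) | a. a \<in> underS W g \<and> ?s |` underS W a \<in> dom isum}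
      = {m (\<Union>i \<in> underS W a. A i) | a. a \<in> underS W g}"
    using restr val by (intro Collect_cong) metis
  ultimately show ?thesis using val(2)[of g] by simp
qed

text \<open>Traces on all measurable \<open>E\<close> are included because the induction on
  coverability applies continuity on the complement of a member of \<open>C\<close>.\<close>

definition continuous_union :: "'y set set \<Rightarrow> bool" where
  "continuous_union C \<longleftrightarrow>
     (\<forall>E \<in> M. isLub UNIV ((\<lambda>A. m (A \<inter> E)) ` C) (m (\<Union>C \<inter> E)))"

text \<open>Transfinite induction on the partial unions of an enumeration of \<open>F\<close>: a
  successor adds one member, a limit is the union of a chain on which the measure is
  continuous.\<close>

lemma small_union_induct:
  assumes F: "F \<subseteq> M" "|F| \<le>o lam" and empty: "P {}"
    and Un: "\<And>A B. A \<in> M \<Longrightarrow> P A \<Longrightarrow> B \<in> F \<Longrightarrow> P (A \<union> B)"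
    and chain: "\<And>C. C \<subseteq> M \<Longrightarrow> \<Union>C \<in> M \<Longrightarrow> C \<noteq> {} \<Longrightarrow> \<forall>A\<in>C. \<forall>B\<in>C. A \<subseteq> B \<or> B \<subseteq> A \<Longrightarrow>
      continuous_union C \<Longrightarrow> \<forall>A\<in>C. P A \<Longrightarrow> P (\<Union>C)"
  shows "P (\<Union>F)"
proof (cases "F = {}")
  case False
  obtain g A where g: "g \<in> ordinals_below_succ W lam" and A: "A ` underS W g = F"
    using small_enumeration[OF F(2) False] by metis
  define U where "U a = (\<Union>i \<in> underS W a. A i)" for a
  note wo = W[folded wo_rel_def]
  have below: "a \<in> ordinals_below_succ W lam" "underS W a \<subseteq> underS W g" "A ` underS W a \<subseteq> M"
    if "a \<in> underS W g \<or> a = g" for a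
    using that g ordinals_below_succ_downward[OF W g] underS_Restr_underS(1)[OF W, of a g] A F(1)
    by blast+
  \<comment> \<open>The case \<open>a = g\<close> is included because it yields the union of all of
    \<open>F\<close>.\<close>
  have "P (U a)" if "a \<in> underS W g \<or> a = g" for a
    using that
  proof (induction a rule: wo_rel.well_order_induct[OF wo])
    case (1 a)
    note a = below[OF 1(2)]
    have IH: "P (U b)" if "b \<in> underS W a" for b
      using 1(1) that a(2) by (auto simp: underS_def)
    have UM: "U b \<in> M" if "b \<in> underS W a" for b
    proof -
      have b: "b \<in> underS W g \<or> b = g" using that a(2) by blast
      show ?thesis unfolding U_def by (rule UN_underS_M[OF below(1,3)[OF b]])
    qed
    show ?case
    proof (cases "underS W a = {}")
      case True
      then show ?thesis using empty by (simp add: U_def)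
    next
      case nonempty: False
      show ?thesis
      proof (cases "limit_ordinal W a")
        case True
        have U: "U a = \<Union>(U ` underS W a)"
        proof -
          have "\<exists>b \<in> underS W a. i \<in> underS W b" if "i \<in> underS W a" for i
            using True that unfolding limit_ordinal_def by blast
          then have "underS W a = (\<Union>b \<in> underS W a. underS W b)"
            using underS_Restr_underS(1)[OF W] by blast
          then have "U a = (\<Union>i \<in> (\<Union>b \<in> underS W a. underS W b). A i)"
            unfolding U_def by simp
          then show ?thesis by (simp add: U_def)
        qed
        have "continuous_union (U ` underS W a)"
          unfolding continuous_union_def
        proof
          fix E assume E: "E \<in> M"
          \<comment> \<open>The continuity lemma is applied to the traces of the \<open>A i\<close>,
            whose partial unions are the traces of the \<open>U b\<close>.\<close>
          have "(\<lambda>i. A i \<inter> E) ` underS W a \<subseteq> M" using a(3) E Int_M by blast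
          from m_limit[OF a(1) this True]
          have "isLub UNIV {m (U b \<inter> E) | b. b \<in> underS W a} (m (U a \<inter> E))"
            unfolding U_def Int_UN_distrib2 by simp
          then show "isLub UNIV ((\<lambda>A. m (A \<inter> E)) ` U ` underS W a) (m (\<Union>(U ` underS W a) \<inter> E))"
            unfolding U[symmetric] image_image by (simp add: setcompr_eq_image)
        qed
        moreover have "U b \<subseteq> U c \<or> U c \<subseteq> U b" if "b \<in> underS W a" "c \<in> underS W a" for b c
        proof -
          have "(b, c) \<in> W \<or> (c, b) \<in> W"
            using that wo_rel.TOTALS[OF wo] Order_Relation.underS_Field[of W a] by blast
          then have "underS W b \<subseteq> underS W c \<or> underS W c \<subseteq> underS W b"
            using underS_incr[OF wo_rel.TRANS[OF wo] wo_rel.ANTISYM[OF wo]] by blast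
          then show ?thesis unfolding U_def by blast
        qed
        moreover have "\<Union>(U ` underS W a) \<in> M"
          unfolding U[symmetric] unfolding U_def by (rule UN_underS_M[OF a(1,3)])
        ultimately show ?thesis
          unfolding U using nonempty UM IH by (intro chain) auto
      next
        case False
        \<comment> \<open>A nonzero ordinal that is not a limit has a last element \<open>b\<close>
          below it.\<close>
        then obtain b where b: "b \<in> underS W a" "\<And>c. c \<in> underS W a \<Longrightarrow> b \<notin> underS W c"
          using nonempty unfolding limit_ordinal_def by blast
        have "c \<in> underS W b \<or> c = b" if "c \<in> underS W a" for c
          using that b wo_rel.TOTALS[OF wo] Order_Relation.underS_Field[of W a]
          by (auto simp: underS_def)
        then have "underS W a = insert b (underS W b)"
          using b(1) underS_Restr_underS(1)[OF W b(1)] by blast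
        then have "U a = U b \<union> A b" by (auto simp: U_def)
        then show ?thesis using Un[OF UM[OF b(1)] IH[OF b(1)]] b(1) a(2) A by auto
      qed
    qed
  qed
  from this[of g] show ?thesis using A by (simp add: U_def)
qed (simp add: empty)

text \<open>Continuity at the limit ordinal omega, with the enumeration \<open>f\<close> of its
  elements inverted to re-index \<open>D\<close>.\<close>

lemma m_UN_nat:
  fixes D :: "nat \<Rightarrow> 'y set"
  assumes D: "\<And>n. D n \<in> M"
  shows "isLub UNIV (range (\<lambda>n. m (\<Union>k<n. D k))) (m (\<Union>n. D n))"
proof -
  obtain g f where g: "g \<in> ordinals_below_succ W lam" and range: "underS W g = range f"
    and inj: "inj f" and segment: "\<And>n::nat. underS W (f n) = f ` {..<n}"
    using embedding_omega[OF W long lam infinite] by metis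
  let ?A = "\<lambda>i. D (inv f i)"
  have limit: "limit_ordinal W g"
    unfolding limit_ordinal_def range
  proof (intro conjI ballI)
    fix a assume "a \<in> range f"
    then obtain n where "a = f n" by blast
    then have "a \<in> underS W (f (Suc n))" unfolding segment by simp
    then show "\<exists>b \<in> range f. a \<in> underS W b" by blast
  qed simp
  have "?A ` underS W g \<subseteq> M" using D by blast
  note lub = m_limit[OF g this limit]
  have "(\<Union>i \<in> underS W (f n). ?A i) = (\<Union>k<n. D k)" for n using inj unfolding segment by simp
  then have "(\<lambda>a. m (\<Union>i \<in> underS W a. ?A i)) ` range f = range (\<lambda>n. m (\<Union>k<n. D k))"
    by (simp add: image_image)
  moreover have "(\<Union>i \<in> range f. ?A i) = (\<Union>n. D n)" using inj by simp
  ultimately show ?thesis using lub unfolding range setcompr_eq_image by simp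
qed

section \<open>Idempotent values\<close>

text \<open>At successors \<open>c + c = c\<close> absorbs the added set; at limits an upper bound
  of all members bounds their supremum.\<close>

lemma m_small_union_le_idempotent:
  assumes F: "F \<subseteq> M" "|F| \<le>o lam" and le: "\<And>A. A \<in> F \<Longrightarrow> m A \<le> c" and idem: "c + c = c"
  shows "m (\<Union>F) \<le> c"
proof (rule small_union_induct[OF F, where P = "\<lambda>A. m A \<le> c"])
  show "m {} \<le> c" by (simp add: m_empty zero_least)
  show "m (A \<union> B) \<le> c" if "A \<in> M" "m A \<le> c" "B \<in> F" for A B
  proof -
    have "m (A \<union> B) \<le> m A + m B" using that F by (intro m_Un_le) auto
    also have "\<dots> \<le> c + c" using that le by (intro add_le_add) auto
    finally show ?thesis using idem by simp
  qed
  show "m (\<Union>C) \<le> c" if C: "C \<subseteq> M" "continuous_union C" "\<forall>A\<in>C. m A \<le> c" for C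
  proof -
    have "isLub UNIV ((\<lambda>A. m (A \<inter> X)) ` C) (m (\<Union>C \<inter> X))"
      using C(2) X_M unfolding continuous_union_def by blast
    moreover have "A \<inter> X = A" if "A \<in> C" for A using that C(1) subset_X by blast
    moreover from this have "\<Union>C \<inter> X = \<Union>C" by blast
    ultimately show ?thesis using C(3) unfolding isLub_UNIV_iff by simp
  qed
qed

lemma small_union_null:
  assumes "F \<subseteq> M" and "|F| \<le>o lam" and "\<And>A. A \<in> F \<Longrightarrow> m A = 0"
  shows "m (\<Union>F) = 0"
  using m_small_union_le_idempotent[of F 0] assms zero_least[of "m (\<Union>F)"] by (simp add: order_antisym)

text \<open>The even and the odd indices give two disjoint parts, each with the measure of the whole
  union.\<close>

lemma m_disjoint_union_idempotent:
  fixes D :: "nat \<Rightarrow> 'y set"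
  assumes D: "\<And>n. D n \<in> M" and disj: "disjoint_family D"
    and inf: "\<And>N. infinite N \<Longrightarrow> m (\<Union>n. D n) \<le> m (\<Union>n\<in>N. D n)"
  shows "m (\<Union>n. D n) + m (\<Union>n. D n) = m (\<Union>n. D n)"
proof -
  let ?U = "\<lambda>N. \<Union>n\<in>N. D n"
  have eq: "m (?U N) = m (\<Union>n. D n)" if "infinite N" for N
    by (rule order_antisym[OF m_mono[OF UN_nat_M[OF D] UN_nat_M[OF D]] inf[OF that]]) blast
  have ex: "infinite {n::nat. even n}" "infinite {n::nat. odd n}"
    unfolding infinite_nat_iff_unbounded_le mem_Collect_eq by presburger+
  have "m (\<Union>n. D n) = m (?U {n. even n} \<union> ?U {n. odd n})"
    by (rule arg_cong[where f = m]) blast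
  also have "\<dots> = m (?U {n. even n}) + m (?U {n. odd n})"
  proof (rule m_Un)
    have "D i \<inter> D j = {}" if "even i" "odd j" for i j
      using that disjoint_family_onD[OF disj, of i j] by auto
    then show "?U {n. even n} \<inter> ?U {n. odd n} = {}" by blast
  qed (intro UN_nat_M D)+
  finally show ?thesis using eq[OF ex(1)] eq[OF ex(2)] by simp
qed

section \<open>Finite covers by small sets\<close>

text \<open>A form of total boundedness, with measure in the role of diameter.\<close>

definition coverable :: "'s \<Rightarrow> 'y set \<Rightarrow> bool" where
  "coverable e A \<longleftrightarrow> (\<exists>F. finite F \<and> F \<subseteq> M \<and> A \<subseteq> \<Union>F \<and> (\<forall>B\<in>F. m B \<le> e))"

lemma coverable_mono: "coverable e B \<Longrightarrow> A \<subseteq> B \<Longrightarrow> coverable e A"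
  unfolding coverable_def by blast

lemma coverable_Un:
  assumes "coverable e A" and "B \<in> M" and "m B \<le> e"
  shows "coverable e (A \<union> B)"
proof -
  obtain F where "finite F" "F \<subseteq> M" "A \<subseteq> \<Union>F" "\<forall>B\<in>F. m B \<le> e"
    using assms(1) unfolding coverable_def by blast
  then show ?thesis
    using assms(2,3) unfolding coverable_def by (intro exI[of _ "insert B F"]) auto
qed

text \<open>If k sets of measure at most \<open>e\<close> cover \<open>A\<close>, then the union of
  any k of the disjoint \<open>D n\<close>, each of measure at least \<open>e\<close>, has at least
  the measure of \<open>A\<close>; and \<open>N\<close> contains k indices.\<close>

lemma coverable_le_infinite_union:
  fixes D :: "nat \<Rightarrow> 'y set"
  assumes A: "coverable e A" "A \<in> M" and D: "\<And>n. D n \<in> M" and disj: "disjoint_family D"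
    and big: "\<And>n. e \<le> m (D n)" and N: "infinite N"
  shows "m A \<le> m (\<Union>n\<in>N. D n)"
proof -
  obtain F where F: "finite F" "F \<subseteq> M" "A \<subseteq> \<Union>F" "\<forall>B\<in>F. m B \<le> e"
    using A(1) unfolding coverable_def by blast
  have "m (\<Union>F) \<le> m (\<Union>n\<in>K. D n)" if "card K = card F" "finite K" for K
    using F(1,2,4) that
  proof (induction F arbitrary: K rule: finite_induct)
    case empty
    then show ?case by (simp add: m_empty)
  next
    case (insert B F)
    then obtain k K' where K: "K = insert k K'" "k \<notin> K'" "card K' = card F" "finite K'"
      by (metis card_Suc_eq card_insert_disjoint finite_insert)
    have FM: "\<Union>F \<in> M"
      using insert by (intro Union_M countable_small countable_finite) auto
    \<comment> \<open>The covering set \<open>B\<close> is matched with \<open>D k\<close>, both as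
      right summands.\<close>
    have "m (\<Union>(insert B F)) \<le> m (\<Union>F) + m B"
      using m_Un_le[OF FM, of B] insert.prems by (simp add: Un_commute)
    also have "\<dots> \<le> m (\<Union>n\<in>K'. D n) + m (D k)"
      using insert K big[of k] by (intro add_le_add) (auto intro: order_trans)
    also have "\<dots> = m ((\<Union>n\<in>K'. D n) \<union> D k)"
    proof (rule m_Un[symmetric])
      show "(\<Union>n\<in>K'. D n) \<inter> D k = {}"
        using K(2) disjoint_family_onD[OF disj, of _ k] by fastforce
    qed (intro UN_nat_M D)+
    finally show ?case by (simp add: K(1) Un_commute)
  qed
  moreover obtain K where "K \<subseteq> N" "card K = card F" "finite K"
    using N infinite_arbitrarily_large by metis
  moreover have "m A \<le> m (\<Union>F)"
    using A(2) F by (intro m_mono Union_M countable_small countable_finite) auto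
  moreover have "m (\<Union>n\<in>K. D n) \<le> m (\<Union>n\<in>N. D n)" if "K \<subseteq> N" for K
    using that by (intro m_mono UN_nat_M D) auto
  ultimately show ?thesis by (meson order_trans)
qed

text \<open>Coverability bounds each finite initial union by the union over any infinite
  \<open>N\<close>; the supremum of the finite unions inherits the bound.\<close>

lemma coverable_blocks_idempotent:
  fixes D :: "nat \<Rightarrow> 'y set"
  assumes D: "\<And>n. D n \<in> M" and disj: "disjoint_family D" and big: "\<And>n. e \<le> m (D n)"
    and cov: "\<And>n. coverable e (\<Union>k<n. D k)"
  shows "m (\<Union>n. D n) + m (\<Union>n. D n) = m (\<Union>n. D n)"
proof (rule m_disjoint_union_idempotent[OF D disj])
  fix N :: "nat set" assume N: "infinite N"
  have "m (\<Union>k<n. D k) \<le> m (\<Union>n\<in>N. D n)" for n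
    by (rule coverable_le_infinite_union[OF cov UN_nat_M D disj big N]) (rule D)
  then show "m (\<Union>n. D n) \<le> m (\<Union>n\<in>N. D n)"
    using m_UN_nat[of D] D unfolding isLub_UNIV_iff by blast
qed

text \<open>
  In the limit step, if no member of the chain exhausts the union up to a set of measure at most
  \<open>e\<close>, then an increasing sequence in the chain has all its differences of measure more
  than \<open>e\<close>.
\<close>

lemma coverable_if_no_idempotent:
  assumes F: "F \<subseteq> M" "|F| \<le>o lam" and le: "\<And>A. A \<in> F \<Longrightarrow> m A \<le> e" and e: "e > 0"
    and no: "\<And>c. c > 0 \<Longrightarrow> c \<le> m (\<Union>F) \<Longrightarrow> c + c \<noteq> c"
  shows "coverable e (\<Union>F)"
proof -
  have UF: "\<Union>F \<in> M" using Union_M[OF F] .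
  \<comment> \<open>Inclusion in \<open>\<Union>F\<close> is carried along to keep the idempotent
    found below within the range of \<open>no\<close>.\<close>
  have "\<Union>F \<subseteq> \<Union>F \<and> coverable e (\<Union>F)"
  proof (rule small_union_induct[OF F, where P = "\<lambda>A. A \<subseteq> \<Union>F \<and> coverable e A"])
    show "{} \<subseteq> \<Union>F \<and> coverable e {}" unfolding coverable_def by auto
    show "A \<union> B \<subseteq> \<Union>F \<and> coverable e (A \<union> B)"
      if "A \<in> M" "A \<subseteq> \<Union>F \<and> coverable e A" "B \<in> F" for A B
      using that F(1) le coverable_Un by blast
  next
    fix C assume C: "C \<subseteq> M" "C \<noteq> {}" "\<forall>A\<in>C. \<forall>B\<in>C. A \<subseteq> B \<or> B \<subseteq> A" "continuous_union C"
      and UC: "\<Union>C \<in> M" and P: "\<forall>A\<in>C. A \<subseteq> \<Union>F \<and> coverable e A"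
    have sub: "\<Union>C \<subseteq> \<Union>F" using P by blast
    have "coverable e (\<Union>C)"
    proof (rule ccontr)
      assume not: "\<not> coverable e (\<Union>C)"
      \<comment> \<open>Otherwise every member of \<open>C\<close> has measure at most
        \<open>e\<close> outside \<open>A\<close>; continuity on \<open>X - A\<close> passes this
        bound to \<open>\<Union>C\<close>, and adding that one remainder to a finite cover of
        \<open>A\<close> would cover \<open>\<Union>C\<close>.\<close>
      have step: "\<exists>B\<in>C. A \<subseteq> B \<and> e < m (B - A)" if A: "A \<in> C" for A
      proof (rule ccontr)
        assume contr: "\<not> ?thesis"
        have AM: "X - A \<in> M" using A C(1) X_M Diff_M by blast
        have diff: "B \<inter> (X - A) = B - A" if "B \<in> C" for B using that C(1) subset_X by blast
        have "m (B \<inter> (X - A)) \<le> e" if B: "B \<in> C" for B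
        proof (cases "A \<subseteq> B")
          case True
          then show ?thesis using contr B by (auto simp: diff not_less)
        next
          case False
          then have empty: "B - A = {}" using C(3) A B by blast
          show ?thesis unfolding diff[OF B] empty m_empty by (rule less_imp_le[OF e])
        qed
        then have small: "m (\<Union>C \<inter> (X - A)) \<le> e"
          using C(4) AM unfolding continuous_union_def isLub_UNIV_iff by blast
        have UM: "\<Union>C \<inter> (X - A) \<in> M" by (rule Int_M[OF UC AM])
        have "\<Union>C = A \<union> (\<Union>C \<inter> (X - A))" using A subset_X[OF UC] by blast
        moreover have "coverable e A" using P A by blast
        ultimately show False using coverable_Un[OF _ UM small] not by metis
      qed
      then obtain s where s: "\<And>A. A \<in> C \<Longrightarrow> s A \<in> C \<and> A \<subseteq> s A \<and> e < m (s A - A)" by metis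
      obtain A0 where A0: "A0 \<in> C" using C(2) by blast
      define A where "A n = (s ^^ n) A0" for n
      have AC: "A n \<in> C" for n by (induction n) (auto simp: A_def A0 s)
      have inc: "A n \<subseteq> A (Suc n)" "e < m (A (Suc n) - A n)" for n
        using s[OF AC[of n]] by (auto simp: A_def)
      have mono: "A n \<subseteq> A k" if "n \<le> k" for n k
        using inc(1) that by (rule lift_Suc_mono_le)
      define D where "D n = A (Suc n) - A n" for n
      have D: "D n \<in> M" for n unfolding D_def using AC C(1) by (intro Diff_M) auto
      have disj: "disjoint_family D"
      proof -
        have "D n \<inter> D k = {}" if "n < k" for n k
          using mono[of "Suc n" k] that by (auto simp: D_def)
        then show ?thesis unfolding disjoint_family_on_def by (metis Int_commute linorder_neqE_nat)
      qed
      have cov: "coverable e (\<Union>k<n. D k)" for n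
      proof (rule coverable_mono)
        show "coverable e (A n)" using P AC by blast
        have "D k \<subseteq> A n" if "k < n" for k using mono[of "Suc k" n] that by (auto simp: D_def)
        then show "(\<Union>k<n. D k) \<subseteq> A n" by blast
      qed
      \<comment> \<open>The blocks exceed \<open>e\<close> while their finite unions are coverable,
        so their total measure is an idempotent of the kind excluded by \<open>no\<close>.\<close>
      have "m (\<Union>n. D n) + m (\<Union>n. D n) = m (\<Union>n. D n)"
        using inc(2) by (intro coverable_blocks_idempotent[OF D disj _ cov]) (simp add: D_def less_imp_le)
      moreover have "m (\<Union>n. D n) \<le> m (\<Union>F)"
      proof (rule m_mono[OF UN_nat_M UF])
        have "D n \<subseteq> \<Union>F" for n using AC[of "Suc n"] P by (auto simp: D_def)
        then show "(\<Union>n. D n) \<subseteq> \<Union>F" by blast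
      qed (rule D)
      moreover have "0 < m (\<Union>n. D n)"
      proof -
        have "0 < m (D 0)" using e inc(2)[of 0] by (simp add: D_def)
        also have "\<dots> \<le> m (\<Union>n. D n)" by (intro m_mono D UN_nat_M) auto
        finally show ?thesis .
      qed
      ultimately show False using no by blast
    qed
    then show "\<Union>C \<subseteq> \<Union>F \<and> coverable e (\<Union>C)" using sub by blast
  qed
  then show ?thesis by blast
qed

end

section \<open>Spaces with a small base\<close>

locale continuous_measure_small_base = continuous_measure lam W isum Y M mu
  for lam :: "'l rel" and W :: "'o rel"
    and isum :: "('o \<rightharpoonup> 's :: positively_totally_ordered_monoid) \<rightharpoonup> 's"
    and Y :: "'y topology" and M :: "'y set set" and mu :: "'y set \<rightharpoonup> 's" +
  fixes B :: "'y set set"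
  assumes base: "is_base Y B" and small: "|B| \<le>o lam" and t0: "t0_space Y"
begin

section \<open>Base sets as neighbourhoods and covers\<close>

lemma base_open: "V \<in> B \<Longrightarrow> openin Y V"
  using base unfolding is_base_def union_of_def arbitrary_def by (auto intro!: exI[of _ "{V}"])

lemma base_M: "V \<in> B \<Longrightarrow> V \<in> M"
  using base_open open_measurable by blast

lemma base_nbhd:
  assumes "openin Y U" and "x \<in> U"
  shows "\<exists>V\<in>B. x \<in> V \<and> V \<subseteq> U"
proof -
  obtain F where "F \<subseteq> B" "\<Union>F = U"
    using assms(1) base unfolding is_base_def union_of_def arbitrary_def by auto
  then show ?thesis using assms(2) by blast
qed

lemma subset_small: "F \<subseteq> B \<Longrightarrow> |F| \<le>o lam"
  using ordLeq_transitive[OF card_of_mono1 small] .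

lemma image_small: "F \<subseteq> B \<Longrightarrow> |h ` F| \<le>o lam"
  by (rule ordLeq_transitive[OF card_of_image subset_small])

text \<open>The base sets around \<open>x\<close> form a local basis, so their measures have infimum
  0, which excludes \<open>e\<close> as a lower bound.\<close>

lemma small_nbhd:
  assumes x: "x \<in> X" and e: "e > 0"
  shows "\<exists>V\<in>B. x \<in> V \<and> m V < e"
proof (rule ccontr)
  assume not: "\<not> ?thesis"
  let ?F = "{V \<in> B. x \<in> V}"
  have "is_open_local_basis Y x ?F"
    unfolding is_open_local_basis_def using base_open base_nbhd by blast
  then have "isGlb UNIV (m ` ?F) 0"
    using x by (intro m_local_basis subset_small) auto
  moreover have "\<forall>y \<in> m ` ?F. e \<le> y" using not by (auto simp: not_less)
  ultimately have "e \<le> 0" unfolding isGlb_UNIV_iff by blast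
  then show False using e by simp
qed

lemma small_cover: "e > 0 \<Longrightarrow> \<Union>{V \<in> B. m V < e} = X"
  using small_nbhd base_M subset_X by blast

text \<open>The space is the union of at most \<open>lam\<close> base sets of measure below
  \<open>c\<close>, so an idempotent \<open>c\<close> would bound its measure.\<close>

lemma no_idempotent:
  assumes "0 < c" and "c < m X"
  shows "c + c \<noteq> c"
proof
  assume "c + c = c"
  then have "m (\<Union>{V \<in> B. m V < c}) \<le> c"
    using base_M by (intro m_small_union_le_idempotent subset_small) auto
  then show False using assms small_cover by simp
qed

text \<open>Otherwise the base sets of measure below \<open>e\<close> would be null and still cover
  the space.\<close>

lemma ex_small_positive:
  assumes "e > 0"
  shows "\<exists>V\<in>B. 0 < m V \<and> m V < e"
proof (rule ccontr)
  assume "\<not> ?thesis"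
  then have "m V = 0" if "V \<in> B" "m V < e" for V
    using that zero_least[of "m V"] by (auto simp: le_less)
  then have "m (\<Union>{V \<in> B. m V < e}) = 0"
    using base_M by (intro small_union_null subset_small) auto
  then show False using small_cover[OF assms] m_X by simp
qed

text \<open>
  If no base set splits \<open>A\<close>, then removing from \<open>A\<close> all its null intersections with base sets and
  with their complements leaves points which no base set separates, hence at most one of them.
\<close>

lemma ex_splitting:
  assumes A: "A \<in> M" and pos: "m A > 0"
  shows "\<exists>V\<in>B. 0 < m (A \<inter> V) \<and> 0 < m (A - V)"
proof (rule ccontr)
  assume "\<not> ?thesis"
  then have split: "m (A \<inter> V) = 0 \<or> m (A - V) = 0" if "V \<in> B" for V
    using that zero_least[of "m (A \<inter> V)"] zero_least[of "m (A - V)"] by (auto simp: le_less)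
  define I where "I = \<Union>((\<lambda>V. A \<inter> V) ` {V \<in> B. m (A \<inter> V) = 0})"
  define D where "D = \<Union>((\<lambda>V. A - V) ` {V \<in> B. m (A - V) = 0})"
  have IM: "I \<in> M" and DM: "D \<in> M"
    unfolding I_def D_def using A base_M Int_M Diff_M by (intro Union_M image_small; auto)+
  have I0: "m I = 0" and D0: "m D = 0"
    unfolding I_def D_def using A base_M Int_M Diff_M by (intro small_union_null image_small; auto)+
  define Z where "Z = A - I - D"
  have ZM: "Z \<in> M" unfolding Z_def using A IM DM by (intro Diff_M)
  have ZX: "Z \<subseteq> X" using ZM by (rule subset_X)
  \<comment> \<open>For each base set \<open>V\<close>, either \<open>A \<inter> V\<close> was
    removed with \<open>I\<close> or \<open>A - V\<close> was removed with \<open>D\<close>, so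
    \<open>Z\<close> misses \<open>V\<close> or lies inside it.\<close>
  have same: "x \<in> V \<longleftrightarrow> y \<in> V" if "x \<in> Z" "y \<in> Z" "V \<in> B" for x y V
    using split[OF that(3)] that unfolding Z_def I_def D_def by blast
  have eq: "x = y" if "x \<in> Z" "y \<in> Z" for x y
  proof (rule ccontr)
    assume "x \<noteq> y"
    moreover have "x \<in> X" "y \<in> X" using that ZX by auto
    ultimately obtain U where U: "openin Y U" "x \<notin> U \<longleftrightarrow> y \<in> U"
      using t0 unfolding t0_space_def by metis
    have "x \<in> U \<longleftrightarrow> y \<in> U"
      using base_nbhd[OF U(1), of x] base_nbhd[OF U(1), of y] same[OF that] by auto
    then show False using U(2) by simp
  qed
  have Z0: "m Z = 0"
  proof (cases "Z = {}")
    case False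
    then obtain x where "x \<in> Z" by blast
    then have "Z = {x}" "x \<in> X" using eq ZX by blast+
    then show ?thesis using singleton_null by simp
  qed (simp add: m_empty)
  have "m A \<le> m (Z \<union> I \<union> D)"
    using A ZM IM DM by (intro m_mono Un_M) (auto simp: Z_def)
  also have "\<dots> \<le> m (Z \<union> I) + m D" using ZM IM DM by (intro m_Un_le Un_M)
  also have "\<dots> \<le> m Z + m I + m D" using ZM IM by (intro add_le_add m_Un_le) auto
  finally show False using pos Z0 I0 D0 by simp
qed

text \<open>A set of positive measure below \<open>e\<close> splits into two parts of positive
  measure, and the smaller of the two values serves as \<open>d\<close>.\<close>

lemma ex_halving:
  fixes e :: 's
  assumes "e > 0"
  shows "\<exists>d>0. d + d < e"
proof -
  obtain A where A: "A \<in> B" "0 < m A" "m A < e" using ex_small_positive[OF assms] by blast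
  obtain V where V: "V \<in> B" "0 < m (A \<inter> V)" "0 < m (A - V)"
    using ex_splitting[OF base_M[OF A(1)] A(2)] by blast
  let ?d = "min (m (A \<inter> V)) (m (A - V))"
  have "?d + ?d \<le> m (A \<inter> V) + m (A - V)" by (intro add_le_add) auto
  also have "\<dots> = m ((A \<inter> V) \<union> (A - V))"
    using A V base_M by (intro m_Un[symmetric] Int_M Diff_M) auto
  also have "(A \<inter> V) \<union> (A - V) = A" by blast
  finally have "?d + ?d < e" using A(3) by simp
  then show ?thesis using V by (intro exI[of _ ?d]) auto
qed

text \<open>\<open>A\<close> is the union of its traces on base sets of measure below
  \<open>e\<close>, and \<open>m A < m X\<close> excludes positive idempotents up to
  \<open>m A\<close>.\<close>

lemma coverable_small:
  assumes A: "A \<in> M" "m A < m X" and e: "e > 0"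
  shows "coverable e A"
proof -
  let ?F = "(\<lambda>V. A \<inter> V) ` {V \<in> B. m V < e}"
  have UF: "\<Union>?F = A"
    using small_cover[OF e] subset_X[OF A(1)] by blast
  have "coverable e (\<Union>?F)"
  proof (rule coverable_if_no_idempotent[OF _ _ _ e])
    show "?F \<subseteq> M" using A base_M Int_M by blast
    show "|?F| \<le>o lam" by (rule image_small) blast
    show "m C \<le> e" if C: "C \<in> ?F" for C
    proof -
      obtain V where V: "C = A \<inter> V" "V \<in> B" "m V < e" using C by blast
      have "m C \<le> m V" unfolding V(1) using A base_M V by (intro m_mono Int_M) auto
      then show ?thesis using V(3) by simp
    qed
    show "c + c \<noteq> c" if "0 < c" "c \<le> m (\<Union>?F)" for c
      using that A(2) unfolding UF by (intro no_idempotent) auto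
  qed
  then show ?thesis unfolding UF .
qed

theorem no_continuous_measure:
  assumes continuum: "|UNIV :: (nat \<Rightarrow> nat) set| \<le>o lam"
  shows False
proof -
  obtain E where "E \<in> B" and E: "0 < m E" "m E < m X" using ex_small_positive[OF m_X] by blast
  then have EM: "E \<in> M" using base_M by blast
  obtain h :: "'s \<Rightarrow> 's" where h: "\<And>e. e > 0 \<Longrightarrow> h e > 0 \<and> h e + h e < e" using ex_halving by metis
  \<comment> \<open>The exponent \<open>Suc n\<close> makes \<open>d 0\<close> already strictly
    smaller than \<open>m E\<close>.\<close>
  define d where "d n = (h ^^ Suc n) (m E)" for n
  have pos: "d n > 0" for n using E(1) h by (induction n) (auto simp: d_def)
  have half: "d (Suc n) + d (Suc n) < d n" for n using h[OF pos[of n]] by (simp add: d_def)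
  have "d 0 + 0 \<le> d 0 + d 0" by (intro add_le_add zero_least order_refl)
  also have "\<dots> < m E" using h[OF E(1)] by (simp add: d_def)
  finally have d0: "d 0 < m E" by simp
  show False
  proof (cases "\<exists>e>0. \<forall>n. e \<le> d n")
    case True
    then obtain e where e: "e > 0" "\<And>n. e \<le> d n" by blast
    obtain F where F: "finite F" "F \<subseteq> M" "E \<subseteq> \<Union>F" "\<forall>A\<in>F. m A \<le> e"
      using coverable_small[OF EM E(2) e(1)] unfolding coverable_def by blast
    \<comment> \<open>All n are treated at once: adding a set of measure at most \<open>e\<close> to
      a union bounded by \<open>d (Suc n)\<close> stays below \<open>d n\<close> by halving.\<close>
    have "m (\<Union>F) \<le> d n" for n
      using F(1,2,4)
    proof (induction F arbitrary: n rule: finite_induct)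
      case empty
      then show ?case using pos[of n] by (simp add: m_empty)
    next
      case (insert A F)
      have "\<Union>F \<in> M" using insert by (intro Union_M countable_small countable_finite) auto
      then have "m (A \<union> \<Union>F) \<le> m A + m (\<Union>F)" using insert.prems by (intro m_Un_le) auto
      also have "\<dots> \<le> d (Suc n) + d (Suc n)"
        using insert e(2)[of "Suc n"] by (intro add_le_add) (auto intro: order_trans)
      finally show ?case using half[of n] by simp
    qed
    moreover have "m E \<le> m (\<Union>F)"
      using EM F by (intro m_mono Union_M countable_small countable_finite) auto
    ultimately show False using d0 by (meson not_less order_trans)
  next
    case False
    \<comment> \<open>Each finite cover is listed as a sequence with repetitions, so that choosing
      one set from each is a function on the naturals.\<close>
    have "\<exists>G :: nat \<Rightarrow> 'y set. (\<forall>k. G k \<in> M \<and> m (G k) \<le> d n) \<and> E \<subseteq> (\<Union>k. G k)" for n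
    proof -
      obtain F where F: "finite F" "F \<subseteq> M" "E \<subseteq> \<Union>F" "\<forall>A\<in>F. m A \<le> d n"
        using coverable_small[OF EM E(2) pos[of n]] unfolding coverable_def by blast
      have "F \<noteq> {}" using F(3) E(1) m_empty by auto
      then have "range (from_nat_into F) = F" using F(1) by (simp add: countable_finite)
      moreover have "from_nat_into F k \<in> F" for k using \<open>F \<noteq> {}\<close> by (rule from_nat_into)
      ultimately show ?thesis using F by (intro exI[of _ "from_nat_into F"]) auto
    qed
    then obtain G :: "nat \<Rightarrow> nat \<Rightarrow> 'y set" where G: "\<And>n k. G n k \<in> M" "\<And>n k. m (G n k) \<le> d n"
      "\<And>n. E \<subseteq> (\<Union>k. G n k)" by metis
    \<comment> \<open>\<open>P f\<close> has measure at most every \<open>d n\<close>, hence is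
      null; every point of \<open>E\<close> lies in some \<open>P f\<close>.\<close>
    define P where "P f = (\<Inter>n. G n (f n))" for f
    have PM: "P f \<in> M" for f
      unfolding P_def using G(1) by (intro Inter_M countable_small) auto
    have P0: "m (P f) = 0" for f
    proof -
      have "m (P f) \<le> d n" for n
      proof -
        have "P f \<subseteq> G n (f n)" by (auto simp: P_def)
        then show ?thesis using m_mono[OF PM G(1)] G(2) order_trans by blast
      qed
      then have "\<not> m (P f) > 0" using False by blast
      then show ?thesis using zero_least[of "m (P f)"] by (simp add: le_less)
    qed
    have small: "|range P| \<le>o lam" by (rule ordLeq_transitive[OF card_of_image continuum])
    have "E \<subseteq> \<Union>(range P)"
    proof
      fix x assume "x \<in> E"
      then have "\<forall>n. \<exists>k. x \<in> G n k" using G(3) by blast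
      then obtain f where "\<And>n. x \<in> G n (f n)" by metis
      then show "x \<in> \<Union>(range P)" unfolding P_def by blast
    qed
    then have "m E \<le> m (\<Union>(range P))" using EM PM small by (intro m_mono Union_M) auto
    also have "\<dots> = 0" using PM P0 small by (intro small_union_null) auto
    finally show False using E(1) by simp
  qed
qed

end

text \<open>A small base is obtained from the weight, and \<open>nat_functions_ordLeq\<close>
  supplies the bound on the continuum.\<close>

theorem corollary8p10:
  fixes lam :: "'l rel" and W :: "'o rel" and Y :: "'y topology"
  assumes "Card_order lam"
    and "is_weak_power_of_two lam lam"
    and "natLeq <o lam"
    and "t0_space Y"
    and "weight Y \<le>o lam"
    and "Well_order W"
    and "cardSuc lam \<le>o W"
  shows "\<not> (\<exists>(isum :: ('o \<rightharpoonup> 's :: positively_totally_ordered_monoid) \<rightharpoonup> 's) M mu.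
           infinitary_sum W isum \<and> continuous_succ_measure_space W isum lam Y M mu)"
proof
  assume "\<exists>(isum :: ('o \<rightharpoonup> 's) \<rightharpoonup> 's) M mu.
    infinitary_sum W isum \<and> continuous_succ_measure_space W isum lam Y M mu"
  then obtain isum :: "('o \<rightharpoonup> 's) \<rightharpoonup> 's" and M mu
    where space: "infinitary_sum W isum" "continuous_succ_measure_space W isum lam Y M mu" by blast
  obtain B where B: "is_base Y B" "|B| \<le>o lam" using assms(5) weight_ordLeq_iff by blast
  have "continuous_measure_small_base lam W isum Y M mu B"
    using assms space B ordLess_imp_ordLeq[OF assms(3)] by unfold_locales
  then show False
    using continuous_measure_small_base.no_continuous_measure nat_functions_ordLeq[OF assms(1-3)]
    by blast
qed

end
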